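(* Let $U\in\mathcal{IC}^{2m}$ and fix an admissible basis $(I,J,K)$. For unit vectors $X_1\in U$, the triple $(\xi,\chi,\eta)=(\langle X_2,Y_2\rangle,\langle X_2,Z_2\rangle,\langle Y_2,Z_2\rangle)$ is an invariant of $U$, i.e. it does not depend on the choice of the unit vector $X_1\in U$. This triple is not an intrinsic property of $U$, i.e. in general it depends on the chosen admissible basis $(I,J,K)$.
   Context: $V$ is a real vector space of dimension $4n$ with a quaternionic structure $\mathcal Q=\mathrm{span}_{\mathbb R}(I,J,K)\subset \mathrm{End}(V)$, where $I,J,K$ are anticommuting complex structures with $IJ=K$; any such triple spanning $\mathcal Q$ is called an admissible basis. $S(\mathcal Q)=\{aI+bJ+cK: a^2+b^2+c^2=1\}$. $\langle\cdot,\cdot\rangle$ is a Euclidean scalar product with $\langle AX,AY\rangle=\langle X,Y\rangle$ for all $A\in S(\mathcal Q)$. $Pr^{W}$ is the orthogonal projection onto $W$. Two subspaces of the same dimension are isoclinic with angle $\phi\in[0,\pi/2]$ if all their principal angles equal $\phi$. $\mathcal{IC}^{2m}$ is the set of $2m$-dimensional real subspaces $U\subseteq V$ such that for every $A\in S(\mathcal Q)$ the pair $(U,AU)$ is isoclinic; its angle is denoted $\theta^A$. For a unit vector $X_1\in U$ put $X_2=\frac{I^{-1}Pr^{IU}X_1}{\cos\theta^I}$, $Y_2=\frac{J^{-1}Pr^{JU}X_1}{\cos\theta^J}$, $Z_2=\frac{K^{-1}Pr^{KU}X_1}{\cos\theta^K}$ whenever the denominator is non-zero. If exactly one cosine vanishes: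 set $X_2:=Y_2$ if $\cos\theta^I=0$; $Y_2:=X_2$ if $\cos\theta^J=0$; $Z_2:=X_2$ if $\cos\theta^K=0$. If exactly two vanish, all three vectors are set equal to the one defined by the formula; if all three vanish, $X_2=Y_2=Z_2$ is any unit vector of $U$ orthogonal to $X_1$. *)

theory Defs
  imports "HOL-Analysis.Analysis"
begin

text \<open>
  V is the type \<open>'a :: euclidean_space\<close> with its inner product \<open>\<bullet>\<close>, and End(V) is the real vector
  space \<open>'a \<Rightarrow>\<^sub>L 'a\<close>: in finite dimension every linear map is bounded.
\<close>

section \<open>Quaternionic structures\<close>

definition complex_structure :: "('a::euclidean_space \<Rightarrow>\<^sub>L 'a) \<Rightarrow> bool" where
  "complex_structure A \<longleftrightarrow> A o\<^sub>L A = - id_blinfun"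

definition admissible_basis ::
  "('a::euclidean_space \<Rightarrow>\<^sub>L 'a) set \<Rightarrow> ('a \<Rightarrow>\<^sub>L 'a) \<Rightarrow> ('a \<Rightarrow>\<^sub>L 'a) \<Rightarrow> ('a \<Rightarrow>\<^sub>L 'a) \<Rightarrow> bool" where
  "admissible_basis Q I J K \<longleftrightarrow>
     complex_structure I \<and> complex_structure J \<and> complex_structure K \<and>
     I o\<^sub>L J = - (J o\<^sub>L I) \<and> I o\<^sub>L K = - (K o\<^sub>L I) \<and> J o\<^sub>L K = - (K o\<^sub>L J) \<and>
     I o\<^sub>L J = K \<and> Q = span {I, J, K}"

definition quaternionic_structure :: "('a::euclidean_space \<Rightarrow>\<^sub>L 'a) set \<Rightarrow> bool" where
  "quaternionic_structure Q \<longleftrightarrow> (\<exists>I J K. admissible_basis Q I J K)"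

text \<open>
  The sphere S(Q). The set of all \<open>aI + bJ + cK\<close> with \<open>a\<^sup>2 + b\<^sup>2 + c\<^sup>2 = 1\<close> is the same for every
  admissible basis of Q, so letting the basis vary makes the definition depend on Q only without
  adding elements.
\<close>

definition quat_sphere :: "('a::euclidean_space \<Rightarrow>\<^sub>L 'a) set \<Rightarrow> ('a \<Rightarrow>\<^sub>L 'a) set" where
  "quat_sphere Q = {a *\<^sub>R I + b *\<^sub>R J + c *\<^sub>R K | a b c I J K.
     admissible_basis Q I J K \<and> a\<^sup>2 + b\<^sup>2 + c\<^sup>2 = 1}"

definition quat_hermitian :: "('a::euclidean_space \<Rightarrow>\<^sub>L 'a) set \<Rightarrow> bool" where
  "quat_hermitian Q \<longleftrightarrow>
     (\<forall>A \<in> quat_sphere Q. \<forall>X Y. blinfun_apply A X \<bullet> blinfun_apply A Y = X \<bullet> Y)"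


section \<open>Principal angles and isoclinic subspaces\<close>

definition orth_proj :: "'a::euclidean_space set \<Rightarrow> 'a \<Rightarrow> 'a" where
  "orth_proj W x = (THE p. p \<in> W \<and> (\<forall>w\<in>W. orthogonal (x - p) w))"

definition principal_candidates ::
  "'a::euclidean_space set \<Rightarrow> 'a set \<Rightarrow> (nat \<Rightarrow> 'a) \<Rightarrow> (nat \<Rightarrow> 'a) \<Rightarrow> nat \<Rightarrow> ('a \<times> 'a) set" where
  "principal_candidates U W u w i =
     {(a, b). a \<in> U \<and> b \<in> W \<and> norm a = 1 \<and> norm b = 1 \<and>
        (\<forall>j<i. orthogonal a (u j) \<and> orthogonal b (w j))}"

text \<open>
  The usual recursive definition of the principal angles of two subspaces of the same dimension,
  indexed from 0: the cosine of the i-th angle is the maximum of \<open>a \<bullet> b\<close> over unit vectors of U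
  and W orthogonal to the principal vectors already chosen, attained at \<open>u i\<close> and \<open>w i\<close>.
  The principal vectors are not unique, the angles are.
\<close>

definition principal_angles :: "'a::euclidean_space set \<Rightarrow> 'a set \<Rightarrow> (nat \<Rightarrow> real) \<Rightarrow> bool" where
  "principal_angles U W \<theta> \<longleftrightarrow>
     (\<exists>u w. \<forall>i<dim U.
        (u i, w i) \<in> principal_candidates U W u w i \<and>
        (\<forall>(a, b) \<in> principal_candidates U W u w i. a \<bullet> b \<le> u i \<bullet> w i) \<and>
        \<theta> i = arccos (u i \<bullet> w i))"

definition isoclinic :: "'a::euclidean_space set \<Rightarrow> 'a set \<Rightarrow> real \<Rightarrow> bool" where
  "isoclinic U W \<phi> \<longleftrightarrow>
     subspace U \<and> subspace W \<and> dim U = dim W \<and> 0 \<le> \<phi> \<and> \<phi> \<le> pi / 2 \<and>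
     (\<exists>\<theta>. principal_angles U W \<theta> \<and> (\<forall>i<dim U. \<theta> i = \<phi>))"

text \<open>The argument m of \<open>IC\<close> is half the real dimension.\<close>

definition IC :: "('a::euclidean_space \<Rightarrow>\<^sub>L 'a) set \<Rightarrow> nat \<Rightarrow> 'a set set" where
  "IC Q m = {U. subspace U \<and> dim U = 2 * m \<and>
     (\<forall>A \<in> quat_sphere Q. \<exists>\<phi>. isoclinic U (blinfun_apply A ` U) \<phi>)}"

text \<open>Unique as soon as \<open>U\<close> is not the zero subspace.\<close>

definition iso_angle :: "'a::euclidean_space set \<Rightarrow> ('a \<Rightarrow>\<^sub>L 'a) \<Rightarrow> real" where
  "iso_angle U A = (THE \<phi>. isoclinic U (blinfun_apply A ` U) \<phi>)"


section \<open>The vectors \<open>X\<^sub>2, Y\<^sub>2, Z\<^sub>2\<close> and the triple\<close>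

definition assoc_vec :: "'a::euclidean_space set \<Rightarrow> ('a \<Rightarrow>\<^sub>L 'a) \<Rightarrow> 'a \<Rightarrow> 'a" where
  "assoc_vec U A X1 =
     inv (blinfun_apply A) (orth_proj (blinfun_apply A ` U) X1) /\<^sub>R cos (iso_angle U A)"

text \<open>
  A relation rather than a function, because \<open>X\<^sub>2 = Y\<^sub>2 = Z\<^sub>2\<close> may be chosen freely when all three
  cosines vanish. In the other cases the nested conditionals pick, for a vector whose own cosine
  is zero, the replacement prescribed by the conventions for one or two vanishing cosines.
\<close>

definition assoc_vectors ::
  "'a::euclidean_space set \<Rightarrow> ('a \<Rightarrow>\<^sub>L 'a) \<Rightarrow> ('a \<Rightarrow>\<^sub>L 'a) \<Rightarrow> ('a \<Rightarrow>\<^sub>L 'a) \<Rightarrow> 'a \<Rightarrow> 'a \<Rightarrow> 'a \<Rightarrow> 'a \<Rightarrow> bool"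
where
  "assoc_vectors U I J K X1 X2 Y2 Z2 \<longleftrightarrow>
     (let cI = cos (iso_angle U I); cJ = cos (iso_angle U J); cK = cos (iso_angle U K);
          fI = assoc_vec U I X1; fJ = assoc_vec U J X1; fK = assoc_vec U K X1
      in if cI = 0 \<and> cJ = 0 \<and> cK = 0
         then X2 \<in> U \<and> norm X2 = 1 \<and> orthogonal X2 X1 \<and> Y2 = X2 \<and> Z2 = X2
         else X2 = (if cI \<noteq> 0 then fI else if cJ \<noteq> 0 then fJ else fK) \<and>
              Y2 = (if cJ \<noteq> 0 then fJ else if cI \<noteq> 0 then fI else fK) \<and>
              Z2 = (if cK \<noteq> 0 then fK else if cI \<noteq> 0 then fI else fJ))"

definition is_triple ::
  "'a::euclidean_space set \<Rightarrow> ('a \<Rightarrow>\<^sub>L 'a) \<Rightarrow> ('a \<Rightarrow>\<^sub>L 'a) \<Rightarrow> ('a \<Rightarrow>\<^sub>L 'a) \<Rightarrow> 'a \<Rightarrow> real \<times> real \<times> real \<Rightarrow> bool"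
where
  "is_triple U I J K X1 t \<longleftrightarrow>
     (\<exists>X2 Y2 Z2. assoc_vectors U I J K X1 X2 Y2 Z2 \<and> t = (X2 \<bullet> Y2, X2 \<bullet> Z2, Y2 \<bullet> Z2))"

end

theory Submission imports Defs begin

text \<open>
  For \<open>A\<close> in the sphere, \<open>T\<^sub>A X = A\<^sup>-\<^sup>1 (Pr X)\<close>, with \<open>Pr\<close> the projection onto \<open>AU\<close>, equals minus the
  projection of \<open>A X\<close> onto \<open>U\<close>, so it is linear in \<open>A\<close>. Isoclinicity says that \<open>T\<^sub>A\<close> multiplies all
  norms on \<open>U\<close> by the cosine of the angle. Applying this to \<open>A\<close>, \<open>B\<close> and \<open>(A + B) / sqrt 2\<close> and
  polarizing shows that the inner product of \<open>T\<^sub>A X\<close> and \<open>T\<^sub>B X\<close> is a constant times the squared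
  norm of \<open>X\<close>, which is the invariance of the triple.

  For the dependence on the basis, every plane belongs to \<open>IC Q 1\<close>. In the plane spanned by \<open>X\<close> and
  \<open>(I + J) X / sqrt 2\<close>, the cosines of \<open>I\<close> and \<open>J\<close> do not vanish, and replacing \<open>(I, J, K)\<close> by
  \<open>(I, - J, - K)\<close> changes the sign of the first component of the triple.
\<close>

section \<open>Orthogonal projections\<close>

text \<open>The difference of two candidates lies in \<open>W\<close> and is orthogonal to itself,
  so the definite description has a unique witness.\<close>

lemma orth_proj_eqI:
  assumes "subspace W" "p \<in> W" "\<And>w. w \<in> W \<Longrightarrow> (x - p) \<bullet> w = 0"
  shows "orth_proj W x = p"
  unfolding orth_proj_def
proof (rule the_equality)
  show "p \<in> W \<and> (\<forall>w\<in>W. orthogonal (x - p) w)"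
    using assms by (auto simp: orthogonal_def)
next
  fix q assume q: "q \<in> W \<and> (\<forall>w\<in>W. orthogonal (x - q) w)"
  then have "q - p \<in> W" using assms subspace_diff by blast
  then have "(x - p) \<bullet> (q - p) = 0" "(x - q) \<bullet> (q - p) = 0"
    using assms q by (auto simp: orthogonal_def)
  then have "(q - p) \<bullet> (q - p) = 0"
    by (simp add: inner_diff_left)
  then show "q = p" by simp
qed

lemma orth_proj:
  assumes "subspace W"
  shows orth_proj_mem: "orth_proj W x \<in> W"
    and orth_proj_inner: "w \<in> W \<Longrightarrow> orth_proj W x \<bullet> w = x \<bullet> w"
proof -
  obtain p z where p: "p \<in> span W" and z: "\<And>w. w \<in> span W \<Longrightarrow> orthogonal z w" and x: "x = p + z"
    using orthogonal_subspace_decomp_exists[of W x] by metis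
  have "orth_proj W x = p"
    using assms p z x by (intro orth_proj_eqI) (auto simp: orthogonal_def span_eq_iff[THEN iffD2])
  then show "orth_proj W x \<in> W" "w \<in> W \<Longrightarrow> orth_proj W x \<bullet> w = x \<bullet> w"
    using assms p z x
    by (auto simp: orthogonal_def span_eq_iff[THEN iffD2] inner_add_left)
qed

lemma linear_orth_proj:
  assumes "subspace W"
  shows "linear (orth_proj W)"
proof (rule linearI)
  fix x y :: 'a and r :: real
  show "orth_proj W (x + y) = orth_proj W x + orth_proj W y"
    using assms by (intro orth_proj_eqI)
      (auto simp: orth_proj_mem orth_proj_inner subspace_add inner_diff_left inner_add_left)
  show "orth_proj W (r *\<^sub>R x) = r *\<^sub>R orth_proj W x"
    using assms by (intro orth_proj_eqI)
      (auto simp: orth_proj_mem orth_proj_inner subspace_scale inner_diff_left)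
qed

lemma norm_orth_proj_sq:
  assumes "subspace W"
  shows "(norm (orth_proj W x))\<^sup>2 = orth_proj W x \<bullet> x"
  using orth_proj_inner[OF assms orth_proj_mem[OF assms], of x x]
  by (simp add: power2_norm_eq_inner inner_commute)

text \<open>Equality case of Cauchy-Schwarz: the projection \<open>p\<close> of \<open>u\<close>
  satisfies \<open>norm p \<le> c\<close> and has inner product \<open>c\<close> with
  \<open>w\<close>, so expanding the squared norm of \<open>p - c w\<close> leaves at most
  0.\<close>

lemma orth_proj_eq_of_maximal:
  assumes W: "subspace W" and w: "w \<in> W" "norm w = 1" and c: "u \<bullet> w = c" "0 \<le> c"
    and le: "\<And>b. b \<in> W \<Longrightarrow> norm b = 1 \<Longrightarrow> u \<bullet> b \<le> c"
  shows "orth_proj W u = c *\<^sub>R w"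
proof -
  let ?p = "orth_proj W u"
  have n: "norm ?p \<le> c"
  proof (cases "?p = 0")
    case False
    \<comment> \<open>The normalized projection is itself a competitor, and its inner product with
      \<open>u\<close> is exactly \<open>norm ?p\<close>.\<close>
    have "u \<bullet> (?p /\<^sub>R norm ?p) \<le> c"
      using False W by (intro le) (auto simp: orth_proj_mem subspace_scale)
    moreover have "u \<bullet> (?p /\<^sub>R norm ?p) = norm ?p"
      using False norm_orth_proj_sq[OF W, of u]
      by (simp add: inner_commute field_simps power2_eq_square)
    ultimately show ?thesis by simp
  qed (use c in simp)
  have "(norm (?p - c *\<^sub>R w))\<^sup>2 = (norm ?p)\<^sup>2 - 2 * c * (?p \<bullet> w) + c\<^sup>2 * (w \<bullet> w)"
    by (simp only: power2_norm_eq_inner)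
      (simp add: inner_diff_left inner_diff_right inner_commute power2_eq_square algebra_simps)
  also have "w \<bullet> w = 1" using w by (simp add: norm_eq_1)
  also have "?p \<bullet> w = c" using W w c by (simp add: orth_proj_inner)
  also have "(norm ?p)\<^sup>2 - 2 * c * c + c\<^sup>2 * 1 \<le> 0"
    using power_mono[OF n, of 2] by (simp add: power2_eq_square)
  finally show ?thesis by simp
qed

section \<open>Isoclinic subspaces\<close>

text \<open>Orthonormal vectors are independent, and there are \<open>dim U\<close> of them.
  Orthogonality is asked only for \<open>j < i\<close>, the form in which principal vectors provide
  it.\<close>

lemma span_orthonormal_eq:
  fixes u :: "nat \<Rightarrow> 'a::euclidean_space"
  assumes "subspace U" "\<And>i. i < dim U \<Longrightarrow> u i \<in> U \<and> norm (u i) = 1"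
    and "\<And>i j. j < i \<Longrightarrow> i < dim U \<Longrightarrow> orthogonal (u i) (u j)"
  shows "span (u ` {..<dim U}) = U"
proof -
  let ?B = "u ` {..<dim U}"
  have orth: "orthogonal (u i) (u j)" if "i \<noteq> j" "i < dim U" "j < dim U" for i j
    using assms(3)[of i j] assms(3)[of j i] that orthogonal_commute[of "u i" "u j"]
    by (cases i j rule: linorder_cases) simp_all
  have "u i \<noteq> u j" if "i \<noteq> j" "i < dim U" "j < dim U" for i j
    using orth[OF that] assms(2)[OF that(2)] by (metis norm_zero orthogonal_self zero_neq_one)
  then have "inj_on u {..<dim U}" by (meson inj_onI lessThan_iff)
  then have card: "card ?B = dim U" by (simp add: card_image)
  have "pairwise orthogonal ?B" unfolding pairwise_image using orth by (simp add: pairwise_def)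
  moreover have "0 \<notin> ?B" using assms(2) by (metis imageE lessThan_iff norm_zero zero_neq_one)
  ultimately have "independent ?B" by (rule pairwise_orthogonal_independent)
  moreover have B: "?B \<subseteq> U" using assms(2) by blast
  ultimately have "U \<subseteq> span ?B"
    using card by (intro card_ge_dim_independent) simp_all
  then show ?thesis
    using span_minimal[OF B assms(1)] by (rule subset_antisym[rotated])
qed

text \<open>Projecting to \<open>W\<close> and back multiplies each principal vector
  \<open>u i\<close> by the squared cosine. These vectors span \<open>U\<close>, so the same holds
  on all of \<open>U\<close>, and self-adjointness of projections turns this into a statement about
  norms.\<close>

lemma norm_orth_proj_isoclinic:
  assumes iso: "isoclinic U W \<phi>" and a: "a \<in> U"
  shows "norm (orth_proj W a) = cos \<phi> * norm a"
proof -
  have U: "subspace U" and W: "subspace W" and \<phi>: "0 \<le> \<phi>" "\<phi> \<le> pi / 2"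
    using iso unfolding isoclinic_def by blast+
  obtain \<theta> where \<theta>: "principal_angles U W \<theta>" "\<And>i. i < dim U \<Longrightarrow> \<theta> i = \<phi>"
    using iso unfolding isoclinic_def by blast
  obtain u w where pa: "\<forall>i<dim U. (u i, w i) \<in> principal_candidates U W u w i \<and>
      (\<forall>(x, y) \<in> principal_candidates U W u w i. x \<bullet> y \<le> u i \<bullet> w i) \<and>
      \<theta> i = arccos (u i \<bullet> w i)"
    using \<theta>(1) unfolding principal_angles_def by blast
  have cand: "(u i, w i) \<in> principal_candidates U W u w i" if "i < dim U" for i
    using pa that by blast
  have max: "x \<bullet> y \<le> u i \<bullet> w i" if "i < dim U" "(x, y) \<in> principal_candidates U W u w i" for i x y
    using pa that by blast
  have arc: "arccos (u i \<bullet> w i) = \<phi>" if "i < dim U" for i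
    using pa \<theta>(2) that by metis
  have c: "cos \<phi> \<ge> 0" using \<phi> by (intro cos_ge_zero) auto
  have u: "u i \<in> U" "norm (u i) = 1" "w i \<in> W" "norm (w i) = 1" if "i < dim U" for i
    using cand[OF that] by (auto simp: principal_candidates_def)
  have uw: "u i \<bullet> w i = cos \<phi>" if "i < dim U" for i
  proof -
    have "\<bar>u i \<bullet> w i\<bar> \<le> 1" using Cauchy_Schwarz_ineq2[of "u i" "w i"] u(2,4)[OF that] by simp
    then show ?thesis using arc[OF that] cos_arccos_abs by metis
  qed
  \<comment> \<open>At index 0 the candidates carry no orthogonality constraint. As all angles are
    equal, every pair \<open>(u i, w i)\<close> is therefore maximal among all unit pairs.\<close>
  have le: "x \<bullet> y \<le> cos \<phi>" if "i < dim U" "x \<in> U" "y \<in> W" "norm x = 1" "norm y = 1" for i x y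
  proof -
    have "0 < dim U" using that(1) by simp
    moreover have "(x, y) \<in> principal_candidates U W u w 0"
      using that(2-) by (simp add: principal_candidates_def)
    ultimately show ?thesis using max uw by metis
  qed
  have PW: "orth_proj W (u i) = cos \<phi> *\<^sub>R w i" if "i < dim U" for i
    by (rule orth_proj_eq_of_maximal[OF W u(3,4)[OF that] uw[OF that] c
          le[OF that u(1)[OF that] _ u(2)[OF that]]])
  have PU: "orth_proj U (w i) = cos \<phi> *\<^sub>R u i" if "i < dim U" for i
  proof (rule orth_proj_eq_of_maximal[OF U u(1,2)[OF that] _ c])
    show "w i \<bullet> u i = cos \<phi>" using uw[OF that] by (metis inner_commute)
    show "w i \<bullet> b \<le> cos \<phi>" if "b \<in> U" "norm b = 1" for b
      using le[OF \<open>i < dim U\<close> that(1) u(3) that(2) u(4)] \<open>i < dim U\<close> by (metis inner_commute)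
  qed
  have "span (u ` {..<dim U}) = U"
  proof (rule span_orthonormal_eq[OF U])
    show "orthogonal (u i) (u j)" if "j < i" "i < dim U" for i j
      using cand[OF that(2)] that(1) by (simp add: principal_candidates_def)
  qed (use u in blast)
  moreover have "(orth_proj U \<circ> orth_proj W) x = (cos \<phi>)\<^sup>2 *\<^sub>R x" if "x \<in> span (u ` {..<dim U})" for x
  proof (rule linear_eq_on_span[OF _ _ _ that])
    show "linear (orth_proj U \<circ> orth_proj W)"
      using U W by (intro linear_compose linear_orth_proj)
    show "linear (\<lambda>x. (cos \<phi>)\<^sup>2 *\<^sub>R x)" by simp
    show "(orth_proj U \<circ> orth_proj W) y = (cos \<phi>)\<^sup>2 *\<^sub>R y" if y: "y \<in> u ` {..<dim U}" for y
    proof -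
      obtain i where "i < dim U" "y = u i" using y by blast
      then show ?thesis
        by (simp add: PW PU power2_eq_square linear_cmul[OF linear_orth_proj[OF U]])
    qed
  qed
  ultimately have "orth_proj U (orth_proj W a) = (cos \<phi>)\<^sup>2 *\<^sub>R a" using a by simp
  then have "(norm (orth_proj W a))\<^sup>2 = (cos \<phi> * norm a)\<^sup>2"
    using orth_proj_inner[OF U a, of "orth_proj W a"]
    by (simp add: norm_orth_proj_sq[OF W] power_mult_distrib flip: power2_norm_eq_inner)
  then show ?thesis using c by (simp add: power2_eq_iff_nonneg[OF norm_ge_zero])
qed

text \<open>A nonzero vector of \<open>U\<close> recovers the cosine as the ratio of the norms of
  its projection and itself, and the cosine is injective on [0, pi].\<close>

lemma iso_angle_eq:
  assumes "isoclinic U (blinfun_apply A ` U) \<phi>" "dim U > 0"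
  shows "iso_angle U A = \<phi>"
  unfolding iso_angle_def
proof (rule the_equality)
  fix \<psi> assume \<psi>: "isoclinic U (blinfun_apply A ` U) \<psi>"
  obtain a where a: "a \<in> U" "a \<noteq> 0" using assms(2) by (metis dim_eq_0 less_irrefl singletonI subsetI)
  then have "cos \<psi> = cos \<phi>"
    using norm_orth_proj_isoclinic[OF assms(1) a(1)] norm_orth_proj_isoclinic[OF \<psi> a(1)] by simp
  then show "\<psi> = \<phi>"
  proof (rule cos_inj_pi[rotated 4])
    have "0 \<le> \<phi> \<and> \<phi> \<le> pi / 2" "0 \<le> \<psi> \<and> \<psi> \<le> pi / 2"
      using assms(1) \<psi> unfolding isoclinic_def by blast+
    then show "0 \<le> \<phi>" "\<phi> \<le> pi" "0 \<le> \<psi>" "\<psi> \<le> pi" using pi_ge_zero by linarith+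
  qed
qed (fact assms(1))

text \<open>The Gram matrix between the two orthonormal bases is \<open>s\<close> times a quarter
  turn, so all principal cosines are the absolute value of \<open>s\<close>. The case of interest is
  \<open>a' = A a\<close>, \<open>b' = A b\<close> with \<open>A\<close> skew.\<close>

lemma isoclinic_plane:
  assumes ab: "norm a = 1" "norm b = 1" "a \<bullet> b = 0"
    and ab': "norm a' = 1" "norm b' = 1" "a' \<bullet> b' = 0"
    and "a \<bullet> a' = 0" "b \<bullet> b' = 0" "a \<bullet> b' = s" "b \<bullet> a' = - s"
  shows "isoclinic (span {a, b}) (span {a', b'}) (arccos \<bar>s\<bar>)"
proof -
  have dim2: "dim (span {x, y}) = 2" if "norm x = 1" "norm y = 1" "x \<bullet> y = 0" for x y :: 'a
  proof -
    have "x \<noteq> y" using that by auto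
    moreover have "independent {x, y}"
      using that by (intro pairwise_orthogonal_independent)
        (auto simp: pairwise_def orthogonal_def inner_commute)
    ultimately show ?thesis by (simp add: dim_eq_card_independent)
  qed
  \<comment> \<open>The only nonzero products pair \<open>a\<close> with \<open>b'\<close> and
    \<open>b\<close> with \<open>a'\<close>; the sign \<open>e\<close> makes both equal to the
    absolute value of \<open>s\<close>.\<close>
  define e :: real where "e = (if s \<ge> 0 then 1 else - 1)"
  have e: "e * s = \<bar>s\<bar>" "\<bar>e\<bar> = 1" "e * e = 1" by (auto simp: e_def)
  define u where "u = (\<lambda>i::nat. if i = 0 then a else b)"
  define w where "w = (\<lambda>i::nat. if i = 0 then e *\<^sub>R b' else - e *\<^sub>R a')"
  have s1: "\<bar>s\<bar> \<le> 1"
    using Cauchy_Schwarz_ineq2[of a b'] assms by auto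
  have le: "x \<bullet> y \<le> \<bar>s\<bar>"
    if "x \<in> span {a, b}" "y \<in> span {a', b'}" "norm x = 1" "norm y = 1" for x y
  proof -
    obtain p q where x: "x = p *\<^sub>R a + q *\<^sub>R b"
      using \<open>x \<in> _\<close> by (auto simp: span_insert algebra_simps)
    obtain r t where y: "y = r *\<^sub>R a' + t *\<^sub>R b'"
      using \<open>y \<in> _\<close> by (auto simp: span_insert algebra_simps)
    have one: "a \<bullet> a = 1" "b \<bullet> b = 1" "a' \<bullet> a' = 1" "b' \<bullet> b' = 1"
      using assms by (auto simp: norm_eq_1)
    have "x \<bullet> x = p * p + q * q" "y \<bullet> y = r * r + t * t"
      using assms one by (auto simp: x y inner_add_left inner_add_right inner_commute)
    then have pq: "p\<^sup>2 + q\<^sup>2 = 1" "r\<^sup>2 + t\<^sup>2 = 1"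
      using that by (auto simp: norm_eq_1 power2_eq_square)
    \<comment> \<open>Lagrange's identity: the determinant \<open>p * t - q * r\<close> of two unit
      coordinate vectors is at most 1 in absolute value.\<close>
    have "(p * t - q * r)\<^sup>2 + (p * r + q * t)\<^sup>2 = (p\<^sup>2 + q\<^sup>2) * (r\<^sup>2 + t\<^sup>2)"
      by (simp add: power2_eq_square algebra_simps)
    then have "(p * t - q * r)\<^sup>2 + (p * r + q * t)\<^sup>2 = 1" unfolding pq by simp
    then have "(p * t - q * r)\<^sup>2 \<le> 1" using zero_le_power2[of "p * r + q * t"] by linarith
    then have "\<bar>p * t - q * r\<bar> \<le> 1" by (simp add: abs_square_le_1)
    then have "\<bar>s * (p * t - q * r)\<bar> \<le> \<bar>s\<bar>"
      unfolding abs_mult by (intro mult_left_le) auto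
    moreover have "x \<bullet> y = s * (p * t - q * r)"
      using assms by (simp add: x y inner_add_left inner_add_right algebra_simps)
    ultimately show ?thesis by linarith
  qed
  have cand: "(u i, w i) \<in> principal_candidates (span {a, b}) (span {a', b'}) u w i" if "i < 2" for i
  proof -
    have "i = 0 \<or> i = 1" using that by auto
    then show ?thesis
      using ab ab' e unfolding principal_candidates_def u_def w_def
      by (auto simp: span_base span_scale span_neg orthogonal_def inner_commute)
  qed
  have uw: "u i \<bullet> w i = \<bar>s\<bar>" for i
    using assms e by (simp add: u_def w_def)
  have "principal_angles (span {a, b}) (span {a', b'}) (\<lambda>i. arccos \<bar>s\<bar>)"
    unfolding principal_angles_def dim2[OF ab]
  proof (rule exI[of _ u], rule exI[of _ w], intro allI impI conjI)
    fix i :: nat assume i: "i < 2"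
    show "(u i, w i) \<in> principal_candidates (span {a, b}) (span {a', b'}) u w i" by (rule cand[OF i])
    show "\<forall>(x, y)\<in>principal_candidates (span {a, b}) (span {a', b'}) u w i. x \<bullet> y \<le> u i \<bullet> w i"
      using le by (auto simp: principal_candidates_def uw)
  qed (simp add: uw)
  then show ?thesis
    unfolding isoclinic_def using s1 dim2[OF ab] dim2[OF ab']
    using arccos_le_pi2[of "\<bar>s\<bar>"] by (auto simp: arccos_lbound)
qed

section \<open>Elements of the quaternionic sphere\<close>

text \<open>The mixed terms cancel by anticommutation, and the squares contribute minus the sum of
  squared coefficients.\<close>

lemma quat_sphere_square:
  assumes "A \<in> quat_sphere Q"
  shows "blinfun_apply A (blinfun_apply A x) = - x"
proof -
  obtain a b c I J K where A: "A = a *\<^sub>R I + b *\<^sub>R J + c *\<^sub>R K" and adm: "admissible_basis Q I J K"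
    and abc: "a\<^sup>2 + b\<^sup>2 + c\<^sup>2 = 1"
    using assms unfolding quat_sphere_def by blast
  have "I o\<^sub>L I = - id_blinfun" "J o\<^sub>L J = - id_blinfun" "K o\<^sub>L K = - id_blinfun"
    "I o\<^sub>L J = - (J o\<^sub>L I)" "I o\<^sub>L K = - (K o\<^sub>L I)" "J o\<^sub>L K = - (K o\<^sub>L J)"
    using adm unfolding admissible_basis_def complex_structure_def by auto
  from this[THEN arg_cong[of _ _ "\<lambda>F. blinfun_apply F x"]]
  have "I (I x) = - x" "J (J x) = - x" "K (K x) = - x"
    "I (J x) = - J (I x)" "I (K x) = - K (I x)" "J (K x) = - K (J x)"
    by (simp_all add: uminus_blinfun.rep_eq)
  then have "A (A x) = - ((a\<^sup>2 + b\<^sup>2 + c\<^sup>2) *\<^sub>R x)"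
    by (simp add: A plus_blinfun.rep_eq scaleR_blinfun.rep_eq blinfun.add_right blinfun.scaleR_right
        power2_eq_square algebra_simps)
  then show ?thesis using abc by simp
qed

lemma quat_sphere_skew:
  assumes "quat_hermitian Q" "A \<in> quat_sphere Q"
  shows "blinfun_apply A x \<bullet> y = - (x \<bullet> blinfun_apply A y)"
proof -
  have "A x \<bullet> y = A (A x) \<bullet> A y" using assms by (auto simp: quat_hermitian_def)
  then show ?thesis by (simp add: quat_sphere_square[OF assms(2)])
qed

lemma quat_sphereI:
  assumes "admissible_basis Q I J K"
  shows "a\<^sup>2 + b\<^sup>2 + c\<^sup>2 = 1 \<Longrightarrow> a *\<^sub>R I + b *\<^sub>R J + c *\<^sub>R K \<in> quat_sphere Q"
  using assms unfolding quat_sphere_def by blast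

text \<open>The normalized pairwise sums are the third elements required for polarization in
  \<open>inner_assoc_vec_const\<close>.\<close>

lemma quat_sphere_basis:
  assumes "admissible_basis Q I J K"
  shows "I \<in> quat_sphere Q" "J \<in> quat_sphere Q" "K \<in> quat_sphere Q"
    and "(1 / sqrt 2) *\<^sub>R (I + J) \<in> quat_sphere Q"
    and "(1 / sqrt 2) *\<^sub>R (I + K) \<in> quat_sphere Q"
    and "(1 / sqrt 2) *\<^sub>R (J + K) \<in> quat_sphere Q"
  using quat_sphereI[OF assms, of 1 0 0] quat_sphereI[OF assms, of 0 1 0]
    quat_sphereI[OF assms, of 0 0 1] quat_sphereI[OF assms, of "1 / sqrt 2" "1 / sqrt 2" 0]
    quat_sphereI[OF assms, of "1 / sqrt 2" 0 "1 / sqrt 2"]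
    quat_sphereI[OF assms, of 0 "1 / sqrt 2" "1 / sqrt 2"]
  by (simp_all add: power_divide scaleR_add_right)

text \<open>Two sign changes preserve \<open>IJ = K\<close>. This is the second basis against which
  the triple is compared.\<close>

lemma admissible_basis_flip:
  assumes "admissible_basis Q I J K"
  shows "admissible_basis Q I (- J) (- K)"
proof -
  have "span {I, - J, - K} = span {I, J, K}"
  proof (rule span_eq[THEN iffD2], intro conjI subsetI)
    fix x assume "x \<in> {I, - J, - K}"
    then show "x \<in> span {I, J, K}" by (auto simp: span_base span_neg)
  next
    fix x assume "x \<in> {I, J, K}"
    then have "x = I \<or> x = - (- J) \<or> x = - (- K)" by auto
    then show "x \<in> span {I, - J, - K}"
      by (metis insertCI span_base span_neg)
  qed
  then show ?thesis
    using assms unfolding admissible_basis_def complex_structure_def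
    by (auto simp: bounded_bilinear.minus_left[OF bounded_bilinear_blinfun_compose] bounded_bilinear.minus_right[OF bounded_bilinear_blinfun_compose])
qed

text \<open>Source of examples: each \<open>A\<close> in the sphere is a skew isometry, which yields
  exactly the inner products required by \<open>isoclinic_plane\<close>.\<close>

lemma quat_hermitian_plane_in_IC:
  assumes herm: "quat_hermitian Q" and ab: "norm a = 1" "norm b = 1" "a \<bullet> b = 0"
  shows "span {a, b} \<in> IC Q 1"
proof -
  have iso: "isoclinic (span {a, b}) (blinfun_apply A ` span {a, b}) (arccos \<bar>a \<bullet> A b\<bar>)"
    if A: "A \<in> quat_sphere Q" for A
  proof -
    have "\<And>x y. A x \<bullet> A y = x \<bullet> y" using herm A by (auto simp: quat_hermitian_def)
    moreover have "blinfun_apply A ` span {a, b} = span {A a, A b}"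
      by (simp add: linear_span_image[OF bounded_linear.linear[OF blinfun.bounded_linear_right], symmetric])
    moreover have "x \<bullet> A x = 0" "b \<bullet> A a = - (a \<bullet> A b)" for x
      using quat_sphere_skew[OF herm A, of x x] quat_sphere_skew[OF herm A, of a b]
      by (simp_all add: inner_commute)
    ultimately show ?thesis
      using ab isoclinic_plane[of a b "A a" "A b" "a \<bullet> A b"]
      by (simp add: norm_eq_sqrt_inner)
  qed
  have "a \<noteq> b" using ab by auto
  moreover have "independent {a, b}"
    using ab by (intro pairwise_orthogonal_independent)
      (auto simp: pairwise_def orthogonal_def inner_commute)
  ultimately have "dim (span {a, b}) = 2" by (simp add: dim_eq_card_independent)
  then show ?thesis using iso unfolding IC_def by auto
qed

section \<open>The associated vectors\<close>

text \<open>An isometry \<open>A\<close> conjugates the projection onto \<open>U\<close> into the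
  one onto \<open>AU\<close>, and the inverse of \<open>A\<close> is \<open>- A\<close>.\<close>

lemma orth_proj_image:
  assumes herm: "quat_hermitian Q" and A: "A \<in> quat_sphere Q" and U: "subspace U"
  shows "orth_proj (blinfun_apply A ` U) x = - A (orth_proj U (A x))"
proof (rule orth_proj_eqI)
  show "subspace (blinfun_apply A ` U)"
    using U by (intro linear_subspace_image bounded_linear.linear[OF blinfun.bounded_linear_right])
  have "- A (orth_proj U (A x)) = A (- orth_proj U (A x))" by (simp add: blinfun.minus_right)
  then show "- A (orth_proj U (A x)) \<in> blinfun_apply A ` U"
    using U by (metis imageI orth_proj_mem subspace_neg)
  fix w assume "w \<in> blinfun_apply A ` U"
  then obtain v where v: "v \<in> U" "w = A v" by auto
  have "A (orth_proj U (A x)) \<bullet> A v = orth_proj U (A x) \<bullet> v"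
    using herm A by (auto simp: quat_hermitian_def)
  then show "(x - - A (orth_proj U (A x))) \<bullet> w = 0"
    using v quat_sphere_skew[OF herm A, of x v] U
    by (simp add: inner_add_left orth_proj_inner)
qed

text \<open>This form exposes a numerator that is linear in \<open>A\<close>, since the projection
  is now onto the fixed subspace \<open>U\<close>.\<close>

lemma assoc_vec_eq:
  assumes herm: "quat_hermitian Q" and A: "A \<in> quat_sphere Q" and U: "subspace U"
  shows "assoc_vec U A x = - orth_proj U (A x) /\<^sub>R cos (iso_angle U A)"
proof -
  have "inj (blinfun_apply A)"
    by (metis A injI minus_minus quat_sphere_square)
  then have "inv (blinfun_apply A) (A (- orth_proj U (A x))) = - orth_proj U (A x)"
    by (rule inv_f_f)
  then show ?thesis
    by (simp add: assoc_vec_def orth_proj_image[OF assms] blinfun.minus_right)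
qed

lemma norm_orth_proj_IC:
  assumes herm: "quat_hermitian Q" and A: "A \<in> quat_sphere Q" and U: "U \<in> IC Q m" and x: "x \<in> U"
  shows "norm (orth_proj U (A x)) = cos (iso_angle U A) * norm x"
proof (cases "m = 0")
  case True
  \<comment> \<open>On the zero subspace the angle is not determined, but both sides vanish.\<close>
  then have "U = {0}" using U x by (auto simp: IC_def dim_eq_0 subspace_0)
  then show ?thesis using x U orth_proj_mem[of U "A x"] by (simp add: IC_def)
next
  case False
  obtain \<phi> where \<phi>: "isoclinic U (blinfun_apply A ` U) \<phi>" using U A by (auto simp: IC_def)
  have "iso_angle U A = \<phi>" using \<phi> False U by (intro iso_angle_eq) (auto simp: IC_def)
  moreover have "norm (A z) = norm z" for z
    using herm A by (simp add: quat_hermitian_def norm_eq_sqrt_inner)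
  ultimately show ?thesis
    using norm_orth_proj_isoclinic[OF \<phi> x] orth_proj_image[OF herm A, of U x] U
    by (simp add: IC_def)
qed

lemma norm_assoc_vec:
  assumes "quat_hermitian Q" "A \<in> quat_sphere Q" "U \<in> IC Q m" "x \<in> U" "norm x = 1"
    and "cos (iso_angle U A) \<noteq> 0"
  shows "norm (assoc_vec U A x) = 1"
proof -
  \<comment> \<open>On a unit vector the cosine is itself a norm.\<close>
  have "cos (iso_angle U A) \<ge> 0"
    using norm_orth_proj_IC[OF assms(1-4)] assms(5) by (metis mult.right_neutral norm_ge_zero)
  then show ?thesis
    using assms norm_orth_proj_IC[OF assms(1-4)] by (simp add: IC_def assoc_vec_eq)
qed

section \<open>Invariance of the triple\<close>

text \<open>Polarization writes the inner product of the two projections through the cosines of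
  \<open>A\<close>, \<open>B\<close> and their normalized sum, none of which involves
  \<open>x\<close>.\<close>

lemma inner_assoc_vec_const:
  assumes herm: "quat_hermitian Q" and A: "A \<in> quat_sphere Q" and B: "B \<in> quat_sphere Q"
    and AB: "(1 / sqrt 2) *\<^sub>R (A + B) \<in> quat_sphere Q" and U: "U \<in> IC Q m"
  obtains k where "\<And>x. x \<in> U \<Longrightarrow> norm x = 1 \<Longrightarrow> assoc_vec U A x \<bullet> assoc_vec U B x = k"
proof -
  let ?C = "(1 / sqrt 2) *\<^sub>R (A + B)"
  let ?c = "\<lambda>F. cos (iso_angle U F)"
  have sub: "subspace U" using U by (simp add: IC_def)
  have ip: "orth_proj U (A x) \<bullet> orth_proj U (B x) = (2 * (?c ?C)\<^sup>2 - (?c A)\<^sup>2 - (?c B)\<^sup>2) / 2"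
    if x: "x \<in> U" "norm x = 1" for x
  proof -
    let ?a = "orth_proj U (A x)" and ?b = "orth_proj U (B x)"
    have "orth_proj U (?C x) = (1 / sqrt 2) *\<^sub>R (?a + ?b)"
      by (simp add: plus_blinfun.rep_eq scaleR_blinfun.rep_eq
          linear_add[OF linear_orth_proj[OF sub]] linear_cmul[OF linear_orth_proj[OF sub]])
    then have "norm (?a + ?b) = sqrt 2 * ?c ?C"
      using norm_orth_proj_IC[OF herm AB U x(1)] x(2)
      by (simp add: divide_simps del: scaleR_add_right)
    then have "(norm (?a + ?b))\<^sup>2 = 2 * (?c ?C)\<^sup>2" by (simp add: power_mult_distrib)
    moreover have "(norm ?a)\<^sup>2 = (?c A)\<^sup>2" "(norm ?b)\<^sup>2 = (?c B)\<^sup>2"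
      using norm_orth_proj_IC[OF herm A U x(1)] norm_orth_proj_IC[OF herm B U x(1)] x(2) by simp_all
    ultimately show ?thesis using dot_norm[of ?a ?b] by simp
  qed
  show ?thesis
  proof (rule that)
    fix x assume x: "x \<in> U" "norm x = 1"
    \<comment> \<open>If a cosine vanishes, \<open>inverse 0 = 0\<close> makes both sides 0, so no
      case distinction is made here.\<close>
    have "assoc_vec U A x \<bullet> assoc_vec U B x =
        inverse (?c A) * (inverse (?c B) * (orth_proj U (A x) \<bullet> orth_proj U (B x)))"
      unfolding assoc_vec_eq[OF herm A sub] assoc_vec_eq[OF herm B sub] by simp
    then show "assoc_vec U A x \<bullet> assoc_vec U B x =
        inverse (?c A) * (inverse (?c B) * ((2 * (?c ?C)\<^sup>2 - (?c A)\<^sup>2 - (?c B)\<^sup>2) / 2))"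
      unfolding ip[OF x] .
  qed
qed

text \<open>Every component is either one of three constant inner products or the squared norm 1 of
  a repeated vector. The equivalence states existence of a triple together with independence of all
  choices.\<close>

lemma is_triple_unique:
  assumes herm: "quat_hermitian Q" and U: "U \<in> IC Q m" and adm: "admissible_basis Q I J K"
  shows "\<exists>t. \<forall>X1 \<in> U. norm X1 = 1 \<longrightarrow> (\<forall>t'. is_triple U I J K X1 t' \<longleftrightarrow> t' = t)"
proof -
  note sph = quat_sphere_basis[OF adm]
  obtain kIJ where kIJ: "\<And>x. x \<in> U \<Longrightarrow> norm x = 1 \<Longrightarrow> assoc_vec U I x \<bullet> assoc_vec U J x = kIJ"
    using inner_assoc_vec_const[OF herm sph(1,2,4) U] by metis
  obtain kIK where kIK: "\<And>x. x \<in> U \<Longrightarrow> norm x = 1 \<Longrightarrow> assoc_vec U I x \<bullet> assoc_vec U K x = kIK"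
    using inner_assoc_vec_const[OF herm sph(1,3,5) U] by metis
  obtain kJK where kJK: "\<And>x. x \<in> U \<Longrightarrow> norm x = 1 \<Longrightarrow> assoc_vec U J x \<bullet> assoc_vec U K x = kJK"
    using inner_assoc_vec_const[OF herm sph(2,3,6) U] by metis
  let ?cI = "cos (iso_angle U I)" and ?cJ = "cos (iso_angle U J)" and ?cK = "cos (iso_angle U K)"
  have unit: "assoc_vec U A x \<bullet> assoc_vec U A x = 1"
    if "A \<in> {I, J, K}" "cos (iso_angle U A) \<noteq> 0" "x \<in> U" "norm x = 1" for A x
    using that norm_assoc_vec[OF herm _ U] sph by (auto simp: norm_eq_1)
  \<comment> \<open>When all cosines vanish, a triple exists only if this free choice can be made; a
    nonzero \<open>U\<close> of even dimension has room for it.\<close>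
  have perp: "\<exists>y. y \<in> U \<and> norm y = 1 \<and> orthogonal y x" if "x \<in> U" "norm x = 1" for x
  proof -
    have "subspace U" "dim U = 2 * m" using U by (auto simp: IC_def)
    moreover have "m \<noteq> 0"
      using that calculation by (metis dim_eq_0 mult_0_right norm_zero singletonD subsetD zero_neq_one)
    moreover have "dim (span {x}) \<le> 1" using dim_le_card[of "{x}" "{x}"] by simp
    ultimately have "span {x} \<subset> U"
      using that span_minimal[of "{x}" U] by (intro psubsetI) auto
    then obtain y where y: "y \<noteq> 0" "y \<in> U" "\<And>z. z \<in> span {x} \<Longrightarrow> orthogonal y z"
      using orthogonal_to_subspace_exists_gen[of "{x}" U] \<open>subspace U\<close> by (metis span_eq_iff)
    then show ?thesis
      using \<open>subspace U\<close>
      by (intro exI[of _ "y /\<^sub>R norm y"]) (auto simp: subspace_scale orthogonal_clauses span_base)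
  qed
  show ?thesis
  proof (cases "?cI = 0 \<and> ?cJ = 0 \<and> ?cK = 0")
    case True
    have "is_triple U I J K x t' \<longleftrightarrow> t' = (1, 1, 1)" if "x \<in> U" "norm x = 1" for x t'
      using perp[OF that] True
      by (auto simp: is_triple_def assoc_vectors_def Let_def norm_eq_1)
    then show ?thesis by blast
  next
    case False
    \<comment> \<open>With one vanishing cosine, the replaced vector coincides with one of the other
      two; with two vanishing, all three vectors coincide.\<close>
    define t where "t = (if ?cI = 0 \<or> ?cJ = 0 then if ?cK = 0 \<or> ?cI = 0 \<and> ?cJ = 0 then (1, 1, 1)
       else if ?cI = 0 then (1, kJK, kJK) else (1, kIK, kIK)
       else if ?cK = 0 then (kIJ, 1, kIJ) else (kIJ, kIK, kJK))"
    have "is_triple U I J K x t' \<longleftrightarrow> t' = t" if "x \<in> U" "norm x = 1" for x t'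
      using False kIJ[OF that] kIK[OF that] kJK[OF that] unit[of I x] unit[of J x] unit[of K x] that
      unfolding is_triple_def assoc_vectors_def Let_def t_def
      by (cases "?cI = 0"; cases "?cJ = 0"; cases "?cK = 0") (simp_all add: inner_commute)
    then show ?thesis by blast
  qed
qed

section \<open>Dependence of the triple on the basis\<close>

lemma triple_depends_on_basis:
  fixes Q :: "('a::euclidean_space \<Rightarrow>\<^sub>L 'a) set"
  assumes herm: "quat_hermitian Q" and adm: "admissible_basis Q I J K"
  obtains U X1 t t' where "U \<in> IC Q 1" "X1 \<in> U" "norm X1 = 1" "is_triple U I J K X1 t"
    "is_triple U I (- J) (- K) X1 t'" "t \<noteq> t'"
proof -
  note sph = quat_sphere_basis[OF adm]
  let ?C = "(1 / sqrt 2) *\<^sub>R (I + J)"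
  obtain x :: 'a where x: "norm x = 1" using vector_choose_size[of 1] by auto
  define y where "y = ?C x"
  define U where "U = span {x, y}"
  have isom: "A v \<bullet> A w = v \<bullet> w" if "A \<in> quat_sphere Q" for A v w
    using herm that by (auto simp: quat_hermitian_def)
  have self: "v \<bullet> A v = 0" if "A \<in> quat_sphere Q" for A v
    using quat_sphere_skew[OF herm that, of v v] by (simp add: inner_commute)
  have y: "norm y = 1" "x \<bullet> y = 0"
    \<comment> \<open>The normalized sum \<open>?C\<close> lies in the sphere, hence is a skew
      isometry: it keeps the norm of \<open>x\<close> and sends it to an orthogonal vector.\<close>
    using x self[OF sph(4)] isom[OF sph(4)] by (simp_all add: y_def norm_eq_sqrt_inner)
  have U: "U \<in> IC Q 1" unfolding U_def by (rule quat_hermitian_plane_in_IC[OF herm x y])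
  have sub: "subspace U" by (simp add: U_def)
  have xU: "x \<in> U" and yU: "y \<in> U" by (auto simp: U_def span_base)
  \<comment> \<open>In the orthonormal basis \<open>x\<close>, \<open>y\<close> of \<open>U\<close>,
    only the \<open>y\<close> coordinate survives; this applies to \<open>I x\<close> and
    \<open>J x\<close>.\<close>
  have proj: "orth_proj U v = (v \<bullet> y) *\<^sub>R y" if "v \<bullet> x = 0" for v
  proof (rule orth_proj_eqI[OF sub])
    show "(v \<bullet> y) *\<^sub>R y \<in> U" using sub yU by (rule subspace_scale)
    fix w assume "w \<in> U"
    then obtain p q where "w = p *\<^sub>R x + q *\<^sub>R y" by (auto simp: U_def span_insert algebra_simps)
    then show "(v - (v \<bullet> y) *\<^sub>R y) \<bullet> w = 0"
      using that x y by (simp add: inner_diff_left inner_diff_right inner_add_right inner_commute norm_eq_1)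
  qed
  have IJ: "I x \<bullet> J x = 0"
  proof -
    have "K = I o\<^sub>L J" using adm unfolding admissible_basis_def by blast
    \<comment> \<open>Skewness of \<open>K = IJ\<close> gives this, and moving \<open>I\<close> to
      the other side gives orthogonality of \<open>I x\<close> and \<open>J x\<close>.\<close>
    then have "x \<bullet> I (J x) = 0" using self[OF sph(3), of x] by simp
    then show ?thesis using quat_sphere_skew[OF herm sph(1), of x "J x"] by simp
  qed
  have "I x \<bullet> I x = 1" "J x \<bullet> J x = 1"
    using isom[OF sph(1), of x x] isom[OF sph(2), of x x] x by (simp_all add: norm_eq_1)
  moreover have "y = (1 / sqrt 2) *\<^sub>R (I x + J x)"
    by (simp add: y_def plus_blinfun.rep_eq scaleR_blinfun.rep_eq)
  ultimately have Iy: "I x \<bullet> y = 1 / sqrt 2" and Jy: "J x \<bullet> y = 1 / sqrt 2"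
    using IJ by (simp_all add: inner_add_right inner_commute[of "J x" "I x"])
  have pI: "orth_proj U (I x) = (1 / sqrt 2) *\<^sub>R y" and pJ: "orth_proj U (J x) = (1 / sqrt 2) *\<^sub>R y"
    using proj[of "I x"] proj[of "J x"] self[OF sph(1), of x] self[OF sph(2), of x]
    unfolding Iy Jy by (metis inner_commute)+
  have "norm ((1 / sqrt 2) *\<^sub>R y) = 1 / sqrt 2" using y by simp
  then have cI: "cos (iso_angle U I) = 1 / sqrt 2" and cJ: "cos (iso_angle U J) = 1 / sqrt 2"
    using norm_orth_proj_IC[OF herm sph(1) U xU] norm_orth_proj_IC[OF herm sph(2) U xU]
    unfolding pI pJ x by (metis mult.right_neutral)+
  have fI: "assoc_vec U I x = - y" and fJ: "assoc_vec U J x = - y"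
    using assoc_vec_eq[OF herm sph(1) sub, of x] assoc_vec_eq[OF herm sph(2) sub, of x]
    by (simp_all add: pI pJ cI cJ)
  note adm' = admissible_basis_flip[OF adm]
  \<comment> \<open>\<open>J\<close> and \<open>- J\<close> have the same image of \<open>U\<close>,
    hence the same cosine, while the numerator of the associated vector changes sign.\<close>
  have "blinfun_apply (- J) ` U = blinfun_apply J ` U"
  proof -
    have "blinfun_apply (- J) ` U = blinfun_apply J ` uminus ` U"
      by (simp add: image_image uminus_blinfun.rep_eq blinfun.minus_right)
    also have "uminus ` U = U"
      using subspace_neg[OF sub] by (force simp: image_iff)
    finally show ?thesis .
  qed
  then have cJ': "cos (iso_angle U (- J)) = 1 / sqrt 2" using cJ by (simp add: iso_angle_def)
  have fJ': "assoc_vec U (- J) x = y"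
    using assoc_vec_eq[OF herm quat_sphere_basis(2)[OF adm'] sub, of x]
    by (simp add: cJ' uminus_blinfun.rep_eq linear_neg[OF linear_orth_proj[OF sub]] pJ)
  have yy: "y \<bullet> y = 1" using y by (simp add: norm_eq_1)
  obtain t where t: "is_triple U I J K x t"
    using is_triple_unique[OF herm U adm] xU x by blast
  obtain t' where t': "is_triple U I (- J) (- K) x t'"
    using is_triple_unique[OF herm U adm'] xU x by blast
  \<comment> \<open>The cosines of \<open>I\<close> and \<open>J\<close> are nonzero, so the first
    component is given by the two formulas whatever the cosine of \<open>K\<close> is.\<close>
  have "fst t = 1"
    using t yy by (auto simp: is_triple_def assoc_vectors_def Let_def cI cJ fI fJ)
  moreover have "fst t' = - 1"
    using t' yy by (auto simp: is_triple_def assoc_vectors_def Let_def cI cJ' fI fJ')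
  ultimately have "t \<noteq> t'" by auto
  with U xU x t t' show ?thesis by (rule that)
qed

theorem proposition6p1:
  fixes Q :: "('a::euclidean_space \<Rightarrow>\<^sub>L 'a) set" and n :: nat
  assumes "DIM('a) = 4 * n"
    and "quaternionic_structure Q"
    and "quat_hermitian Q"
  shows "(\<forall>m. \<forall>U \<in> IC Q m. \<forall>I J K. admissible_basis Q I J K \<longrightarrow>
            (\<exists>t. \<forall>X1 \<in> U. norm X1 = 1 \<longrightarrow> (\<forall>t'. is_triple U I J K X1 t' \<longleftrightarrow> t' = t)))
       \<and> (\<exists>m. \<exists>U \<in> IC Q m. \<exists>I J K I' J' K'. admissible_basis Q I J K \<and> admissible_basis Q I' J' K' \<and>
            (\<exists>X1 \<in> U. norm X1 = 1 \<and>
               (\<exists>t t'. is_triple U I J K X1 t \<and> is_triple U I' J' K' X1 t' \<and> t \<noteq> t')))"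
proof (intro conjI allI ballI impI)
  obtain I J K where adm: "admissible_basis Q I J K"
    using assms(2) by (auto simp: quaternionic_structure_def)
  show "\<exists>m. \<exists>U \<in> IC Q m. \<exists>I J K I' J' K'. admissible_basis Q I J K \<and> admissible_basis Q I' J' K' \<and>
          (\<exists>X1 \<in> U. norm X1 = 1 \<and>
             (\<exists>t t'. is_triple U I J K X1 t \<and> is_triple U I' J' K' X1 t' \<and> t \<noteq> t'))"
    using triple_depends_on_basis[OF assms(3) adm] adm admissible_basis_flip[OF adm] by metis
qed (rule is_triple_unique[OF assms(3)])

end
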